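(* Let $\mathcal{D}=(E,D)$ be the Desargues complex. Then $(E,J(T(D)))$ is a proper matroid extension of $\mathcal{D}$, and every proper matroid extension of $\mathcal{D}$ equals $(E,J(T(D)))$.
   Context: Let $K_5$ be the complete graph on $\{1,2,3,4,5\}$ and let $E$ be its set of edges (2-subsets, written $ab$). The Desargues complex is $\mathcal{D}=(E,D)$ where $D$ is the set of all edge sets of subforests of $K_5$ with at most $3$ edges (including the empty set); it is a simplicial complex of dimension $2$. A simplicial complex is a pair $(V,H)$ with $V$ finite nonempty, $H\subseteq 2^V$ containing all singletons and closed under subsets; its dimension is $\max\{|X|:X\in H\}-1$; it is a matroid if for all $I,J\in H$ with $|I|=|J|+1$ there is $i\in I\setminus J$ with $J\cup\{i\}\in H$. For a complex $(V,H)$ of dimension $d$, $T(H)=\{T\subseteq V \mid X\cup\{p\}\in H \text{ for all } X\in H \text{ with } |X|\le d,\ X\subseteq T, \text{ and all } p\in V\setminus T\}$. For a family $R\subseteq 2^V$, $J(R)$ is the set of all transversals of successive differences of chains in $R$, i.e. sets $\{x_1,\dots,x_k\}$ such that there is a chain $F_0\subset\cdots\subset F_k$ in $R$ with $x_i\in F_i\setminus F_{i-1}$. An extension of a complex $(V,H)$ of dimension $d$ is a complex $(V,H')$ with $H'\cap P_{\le d+1}(V)=H$ ($P_{\le k}(V)$ = subsets with at most $k$ elements); it is proper if $H'\ne H$. *)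

theory Defs
  imports Main
begin

definition abstract_complex :: "'a set \<Rightarrow> 'a set set \<Rightarrow> bool" where
  "abstract_complex V H \<longleftrightarrow>
     finite V \<and> V \<noteq> {} \<and> H \<subseteq> Pow V \<and> (\<forall>v\<in>V. {v} \<in> H) \<and>
     (\<forall>X\<in>H. \<forall>Y. Y \<subseteq> X \<longrightarrow> Y \<in> H)"

text \<open>A complex has a nonempty vertex set and contains all singletons, so the maximum below is
  at least 1 and the subtraction on natural numbers does not truncate.\<close>

definition complex_dim :: "'a set set \<Rightarrow> nat" where
  "complex_dim H = Max (card ` H) - 1"

definition matroid_complex :: "'a set \<Rightarrow> 'a set set \<Rightarrow> bool" where
  "matroid_complex V H \<longleftrightarrow>
     abstract_complex V H \<and>
     (\<forall>I\<in>H. \<forall>J\<in>H. card I = card J + 1 \<longrightarrow> (\<exists>i\<in>I - J. J \<union> {i} \<in> H))"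

definition T_family :: "'a set \<Rightarrow> 'a set set \<Rightarrow> 'a set set" where
  "T_family V H =
     {T. T \<subseteq> V \<and>
         (\<forall>X\<in>H. card X \<le> complex_dim H \<and> X \<subseteq> T \<longrightarrow> (\<forall>p\<in>V - T. X \<union> {p} \<in> H))}"

text \<open>The case \<open>k = 0\<close> is allowed: the empty set is a transversal as soon as \<open>R\<close> is nonempty.\<close>

definition J_family :: "'a set set \<Rightarrow> 'a set set" where
  "J_family R =
     {X. \<exists>(k::nat) F x.
          (\<forall>i\<le>k. F i \<in> R) \<and>
          (\<forall>i\<in>{1..k}. F (i - 1) \<subset> F i \<and> x i \<in> F i - F (i - 1)) \<and>
          X = x ` {1..k}}"

definition complex_extension :: "'a set \<Rightarrow> 'a set set \<Rightarrow> 'a set set \<Rightarrow> bool" where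
  "complex_extension V H H' \<longleftrightarrow>
     abstract_complex V H \<and> abstract_complex V H' \<and>
     H' \<inter> {X. X \<subseteq> V \<and> card X \<le> complex_dim H + 1} = H"

definition proper_complex_extension :: "'a set \<Rightarrow> 'a set set \<Rightarrow> 'a set set \<Rightarrow> bool" where
  "proper_complex_extension V H H' \<longleftrightarrow> complex_extension V H H' \<and> H' \<noteq> H"

definition graph_cycle :: "'v set set \<Rightarrow> 'v list \<Rightarrow> bool" where
  "graph_cycle F vs \<longleftrightarrow>
     length vs \<ge> 3 \<and> distinct vs \<and>
     (\<forall>i<length vs. {vs ! i, vs ! (Suc i mod length vs)} \<in> F)"

definition forest_edges :: "'v set set \<Rightarrow> bool" where
  "forest_edges F \<longleftrightarrow> \<not> (\<exists>vs. graph_cycle F vs)"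

definition K5_edges :: "nat set set" where
  "K5_edges = {e. e \<subseteq> {1..5} \<and> card e = 2}"

definition Desargues :: "nat set set set" where
  "Desargues = {F. F \<subseteq> K5_edges \<and> forest_edges F \<and> card F \<le> 3}"

end

theory Submission
  imports Defs
begin

text \<open>The members of \<open>T(D)\<close> are the edge sets closed under completing triangles, that is, the flats
  of the cycle matroid of \<open>K\<^sub>5\<close>, so \<open>J(T(D))\<close> consists of all forests. For uniqueness, let \<open>H'\<close> be
  a proper matroid extension. Triangles are circuits of \<open>H'\<close>, so the closure of a set in \<open>H'\<close>
  contains its closure in the cycle matroid. Hence the independent sets of \<open>H'\<close> are forests.
  Conversely, \<open>H'\<close> has rank at least 4, and a forest with four edges spans \<open>K\<^sub>5\<close>, so it spans \<open>H'\<close>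
  and is therefore independent in \<open>H'\<close>.\<close>

section \<open>Matroids given by a closure operator\<close>

locale closure_matroid =
  fixes V :: "'a set" and cl :: "'a set \<Rightarrow> 'a set"
  assumes finite_V: "finite V"
    and cl_subset: "X \<subseteq> V \<Longrightarrow> cl X \<subseteq> V"
    and cl_extensive: "X \<subseteq> V \<Longrightarrow> X \<subseteq> cl X"
    and cl_mono: "X \<subseteq> Y \<Longrightarrow> Y \<subseteq> V \<Longrightarrow> cl X \<subseteq> cl Y"
    and cl_idem: "X \<subseteq> V \<Longrightarrow> cl (cl X) = cl X"
    and cl_exchange: "X \<subseteq> V \<Longrightarrow> x \<in> V \<Longrightarrow> y \<in> V \<Longrightarrow> y \<in> cl (insert x X) \<Longrightarrow> y \<notin> cl X
      \<Longrightarrow> x \<in> cl (insert y X)"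
begin

definition indep :: "'a set \<Rightarrow> bool" where
  "indep X \<longleftrightarrow> X \<subseteq> V \<and> (\<forall>x\<in>X. x \<notin> cl (X - {x}))"

lemma indep_subset_V: "indep X \<Longrightarrow> X \<subseteq> V"
  by (simp add: indep_def)

lemma indep_finite: "indep X \<Longrightarrow> finite X"
  using finite_V finite_subset indep_subset_V by blast

lemma indep_empty: "indep {}"
  by (simp add: indep_def)

lemma indep_subset:
  assumes "indep X" and "Y \<subseteq> X"
  shows "indep Y"
proof -
  have "y \<notin> cl (Y - {y})" if "y \<in> Y" for y
  proof -
    have "cl (Y - {y}) \<subseteq> cl (X - {y})"
      using assms indep_subset_V[OF assms(1)] by (intro cl_mono) auto
    then show ?thesis
      using assms that by (auto simp: indep_def)
  qed
  then show ?thesis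
    using assms by (auto simp: indep_def)
qed

text \<open>If adding \<open>y\<close> made some \<open>x\<close> in \<open>X\<close> depend on the
  others, exchange would put \<open>y\<close> into \<open>cl X\<close>.\<close>

lemma indep_insert:
  assumes X: "indep X" and y: "y \<in> V" "y \<notin> cl X"
  shows "indep (insert y X)"
proof -
  have XV: "X \<subseteq> V" using X by (rule indep_subset_V)
  have yX: "y \<notin> X" using cl_extensive[OF XV] y by blast
  have "x \<notin> cl (insert y X - {x})" if "x \<in> X" for x
  proof
    assume "x \<in> cl (insert y X - {x})"
    moreover have "insert y X - {x} = insert y (X - {x})" using that yX by auto
    ultimately have "y \<in> cl (insert x (X - {x}))"
      using cl_exchange[of "X - {x}" y x] X that XV y(1) by (auto simp: indep_def)
    then show False using that y(2) by (simp add: insert_absorb)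
  qed
  moreover have "insert y X - {y} = X" using yX by auto
  ultimately show ?thesis using XV y by (auto simp: indep_def)
qed

lemma cl_subset_cl: "X \<subseteq> cl Y \<Longrightarrow> Y \<subseteq> V \<Longrightarrow> cl X \<subseteq> cl Y"
  using cl_mono[of X "cl Y"] cl_subset[of Y] cl_idem[of Y] by simp

text \<open>Steinitz exchange. An element \<open>x\<close> of \<open>I - J\<close> is traded for
  some \<open>y\<close> in \<open>J\<close> outside \<open>cl (I - {x})\<close>. Such a
  \<open>y\<close> exists, since otherwise \<open>cl J\<close>, and with it \<open>x\<close>, would
  lie in that closure. The trade keeps independence, size and containment in \<open>cl J\<close>
  while \<open>I - J\<close> shrinks, until \<open>I\<close> lies in \<open>J\<close>.\<close>

lemma indep_card_le:
  assumes "indep I" and "J \<subseteq> V" and "I \<subseteq> cl J"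
  shows "card I \<le> card J"
  using assms
proof (induction "card (I - J)" arbitrary: I rule: less_induct)
  case less
  have finJ: "finite J" using less.prems(2) finite_V finite_subset by blast
  have finI: "finite I" using less.prems(1) by (rule indep_finite)
  show ?case
  proof (cases "I \<subseteq> J")
    case True
    then show ?thesis using finJ by (rule card_mono[rotated])
  next
    case False
    then obtain x where x: "x \<in> I" "x \<notin> J" by blast
    have IV: "I - {x} \<subseteq> V" using less.prems(1) indep_subset_V by blast
    have "x \<notin> cl (I - {x})" using less.prems(1) x by (auto simp: indep_def)
    then have "\<not> J \<subseteq> cl (I - {x})"
      using cl_subset_cl[OF _ IV] less.prems(3) x(1) by blast
    then obtain y where y: "y \<in> J" "y \<notin> cl (I - {x})" by blast
    have yI: "y \<notin> I" using cl_extensive[OF IV] x y by blast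
    let ?I = "insert y (I - {x})"
    have ind: "indep ?I"
      using less.prems(2) y indep_subset[OF less.prems(1)] by (intro indep_insert) auto
    have "?I \<subseteq> cl J" using less.prems(3) cl_extensive[OF less.prems(2)] y(1) by blast
    moreover have "card (?I - J) < card (I - J)"
      using finI x y by (intro psubset_card_mono) auto
    ultimately have "card ?I \<le> card J"
      by (intro less.hyps[OF _ ind less.prems(2)])
    moreover have "card ?I = card I"
      using finI x yI by (metis Diff_iff card_Suc_Diff1 card_insert_disjoint finite_Diff)
    ultimately show ?thesis by simp
  qed
qed

text \<open>By \<open>indep_card_le\<close> a larger independent \<open>I\<close> cannot lie inside
  \<open>cl J\<close>, and any element of \<open>I\<close> outside \<open>cl J\<close> extends
  \<open>J\<close>. Looplessness is what makes singletons independent.\<close>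

lemma matroid_complex_indep:
  assumes "V \<noteq> {}" and loopless: "\<And>v. v \<in> V \<Longrightarrow> v \<notin> cl {}"
  shows "matroid_complex V (Collect indep)"
proof -
  have "indep {v}" if "v \<in> V" for v
    using indep_insert[OF indep_empty that loopless[OF that]] .
  then have "abstract_complex V (Collect indep)"
    unfolding abstract_complex_def
    using assms(1) finite_V by (blast intro: indep_subset dest: indep_subset_V)
  moreover have "\<exists>i\<in>I - J. indep (J \<union> {i})"
    if "indep I" "indep J" "card I = card J + 1" for I J
  proof -
    have JV: "J \<subseteq> V" using that(2) by (rule indep_subset_V)
    have "\<not> I \<subseteq> cl J" using indep_card_le[OF that(1) JV] that(3) by auto
    then obtain i where i: "i \<in> I" "i \<notin> cl J" by blast
    moreover have "i \<notin> J" using i cl_extensive[OF JV] by blast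
    moreover have "indep (insert i J)"
      using indep_insert[OF that(2) _ i(2)] i(1) indep_subset_V[OF that(1)] by blast
    ultimately show ?thesis by auto
  qed
  ultimately show ?thesis by (simp add: matroid_complex_def)
qed

text \<open>The flat \<open>F k\<close> contains all earlier choices and hence their closure, so an
  element chosen outside \<open>F k\<close> is independent of them.\<close>

lemma transversal_of_flats_indep:
  fixes k :: nat
  assumes F: "\<forall>i\<le>k. F i \<subseteq> V \<and> cl (F i) = F i"
    and x: "\<forall>i\<in>{1..k}. F (i - 1) \<subset> F i \<and> x i \<in> F i - F (i - 1)"
  shows "indep (x ` {1..k}) \<and> x ` {1..k} \<subseteq> F k"
  using assms
proof (induction k)
  case 0
  then show ?case by (simp add: indep_empty)
next
  case (Suc k)
  have IH: "indep (x ` {1..k})" "x ` {1..k} \<subseteq> F k"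
    using Suc.IH Suc.prems by auto
  have step: "F k \<subset> F (Suc k)" "x (Suc k) \<in> F (Suc k) - F k"
    using Suc.prems(2) by force+
  have fl: "F k \<subseteq> V" "cl (F k) = F k" "F (Suc k) \<subseteq> V" using Suc.prems(1) by auto
  have "x (Suc k) \<notin> cl (x ` {1..k})" using cl_mono[OF IH(2) fl(1)] fl(2) step(2) by blast
  then have "indep (insert (x (Suc k)) (x ` {1..k}))"
    using IH(1) step(2) fl(3) by (intro indep_insert) auto
  moreover have "x ` {1..Suc k} = insert (x (Suc k)) (x ` {1..k})"
    by (simp add: atLeastAtMostSuc_conv)
  ultimately show ?case using IH(2) step by auto
qed

text \<open>The elements of \<open>X\<close> are added one at a time, and the flats are the closures
  of the initial segments. The last conjunct \<open>F k = cl X\<close> is carried along so that the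
  chain can be continued in the induction.\<close>

lemma indep_transversal_of_flats:
  assumes "indep X"
  shows "\<exists>(k::nat) F x. (\<forall>i\<le>k. F i \<subseteq> V \<and> cl (F i) = F i) \<and>
    (\<forall>i\<in>{1..k}. F (i - 1) \<subset> F i \<and> x i \<in> F i - F (i - 1)) \<and> X = x ` {1..k} \<and> F k = cl X"
  using indep_finite[OF assms] assms
proof (induction X rule: finite_induct)
  case empty
  then show ?case
    by (intro exI[of _ 0] exI[of _ "\<lambda>_. cl {}"]) (simp add: cl_subset cl_idem)
next
  case (insert y X)
  have X: "indep X" using insert.prems indep_subset by blast
  obtain k :: nat and F x where F: "\<forall>i\<le>k. F i \<subseteq> V \<and> cl (F i) = F i"
    and x: "\<forall>i\<in>{1..k}. F (i - 1) \<subset> F i \<and> x i \<in> F i - F (i - 1)"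
    and Xx: "X = x ` {1..k}" and Fk: "F k = cl X"
    using insert.IH[OF X] by blast
  let ?F = "F(Suc k := cl (insert y X))" and ?x = "x(Suc k := y)"
  have yXV: "insert y X \<subseteq> V" using insert.prems by (rule indep_subset_V)
  have "y \<notin> cl X" using insert.prems insert.hyps(2) by (auto simp: indep_def)
  moreover have "y \<in> cl (insert y X)" using cl_extensive[OF yXV] by blast
  moreover have "cl X \<subseteq> cl (insert y X)" using cl_mono[OF _ yXV] by blast
  ultimately have "\<forall>i\<in>{1..Suc k}. ?F (i - 1) \<subset> ?F i \<and> ?x i \<in> ?F i - ?F (i - 1)"
    using x Fk by (auto simp: atLeastAtMostSuc_conv)
  moreover have "\<forall>i\<le>Suc k. ?F i \<subseteq> V \<and> cl (?F i) = ?F i"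
    using F cl_subset[OF yXV] cl_idem[OF yXV] by (simp add: le_Suc_eq)
  moreover have "insert y X = ?x ` {1..Suc k}"
    using Xx by (auto simp: atLeastAtMostSuc_conv)
  moreover have "?F (Suc k) = cl (insert y X)" by simp
  ultimately show ?case by blast
qed

lemma J_family_flats: "J_family {F. F \<subseteq> V \<and> cl F = F} = Collect indep"
proof (intro equalityI subsetI)
  fix X assume "X \<in> J_family {F. F \<subseteq> V \<and> cl F = F}"
  then obtain k :: nat and F x where "\<forall>i\<le>k. F i \<subseteq> V \<and> cl (F i) = F i"
    and "\<forall>i\<in>{1..k}. F (i - 1) \<subset> F i \<and> x i \<in> F i - F (i - 1)" and "X = x ` {1..k}"
    unfolding J_family_def by auto
  then show "X \<in> Collect indep" using transversal_of_flats_indep by simp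
next
  fix X assume "X \<in> Collect indep"
  then obtain k :: nat and F x where "\<forall>i\<le>k. F i \<in> {F. F \<subseteq> V \<and> cl F = F}"
    and "\<forall>i\<in>{1..k}. F (i - 1) \<subset> F i \<and> x i \<in> F i - F (i - 1)" and "X = x ` {1..k}"
    using indep_transversal_of_flats[of X] by auto
  then show "X \<in> J_family {F. F \<subseteq> V \<and> cl F = F}"
    unfolding J_family_def mem_Collect_eq[of X] by (intro exI conjI)
qed

end

section \<open>Spanned elements in a matroid complex\<close>

text \<open>For \<open>I\<close> in a matroid complex \<open>H\<close> this is the matroid closure
  of \<open>I\<close>. Members of \<open>I\<close> are listed separately because inserting them
  changes nothing and so stays in \<open>H\<close>. Closures of independent sets suffice for the
  uniqueness argument.\<close>

definition spanned :: "'a set \<Rightarrow> 'a set set \<Rightarrow> 'a set \<Rightarrow> 'a set" where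
  "spanned V H I = {e \<in> V. e \<in> I \<or> insert e I \<notin> H}"

lemma complex_finite: "abstract_complex V H \<Longrightarrow> X \<in> H \<Longrightarrow> finite X"
  unfolding abstract_complex_def by (meson PowD finite_subset subsetD)

lemma complex_subset: "abstract_complex V H \<Longrightarrow> X \<in> H \<Longrightarrow> Y \<subseteq> X \<Longrightarrow> Y \<in> H"
  unfolding abstract_complex_def by blast

text \<open>The matroid axiom compares sizes that differ by exactly one, so \<open>I\<close> is
  first cut down to \<open>card J + 1\<close> elements.\<close>

lemma matroid_augment:
  assumes H: "matroid_complex V H" and I: "I \<in> H" and J: "J \<in> H" and "card J < card I"
  shows "\<exists>i\<in>I - J. insert i J \<in> H"
proof -
  have cx: "abstract_complex V H" using H by (simp add: matroid_complex_def)
  obtain I' where I': "I' \<subseteq> I" "card I' = card J + 1"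
    using obtain_subset_with_card_n[of "card J + 1" I] assms(4) by auto
  then have "I' \<in> H" using complex_subset[OF cx I] by blast
  then show ?thesis using H J I' unfolding matroid_complex_def by fastforce
qed

lemma matroid_augment_to_card:
  assumes H: "matroid_complex V H" and I: "I \<in> H" and J: "J \<in> H" and "card J \<le> card I"
  shows "\<exists>K\<in>H. J \<subseteq> K \<and> K \<subseteq> I \<union> J \<and> card K = card I"
  using J assms(4)
proof (induction "card I - card J" arbitrary: J)
  case 0
  then show ?case by (intro bexI[of _ J]) auto
next
  case (Suc n)
  have finJ: "finite J"
    using H Suc.prems complex_finite by (auto simp: matroid_complex_def)
  have "card J < card I" using Suc.hyps(2) by simp
  then obtain i where i: "i \<in> I - J" "insert i J \<in> H"
    using matroid_augment[OF H I Suc.prems(1)] by blast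
  have "card (insert i J) = Suc (card J)" using i finJ by simp
  then have "n = card I - card (insert i J)" "card (insert i J) \<le> card I"
    using Suc.hyps(2) by auto
  then obtain K where "K \<in> H" "insert i J \<subseteq> K" "K \<subseteq> I \<union> insert i J" "card K = card I"
    using Suc.hyps(1)[OF _ i(2)] by blast
  then show ?case using i by blast
qed

text \<open>A larger \<open>K\<close> would augment \<open>I\<close> by an element that
  \<open>I\<close> already spans.\<close>

lemma spanned_card_le:
  assumes H: "matroid_complex V H" and I: "I \<in> H" and K: "K \<in> H" "K \<subseteq> spanned V H I"
  shows "card K \<le> card I"
proof (rule ccontr)
  assume "\<not> card K \<le> card I"
  then obtain i where "i \<in> K - I" "insert i I \<in> H"
    using matroid_augment[OF H K(1) I] by auto
  then show False using K(2) by (auto simp: spanned_def)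
qed

text \<open>Extend \<open>{a, b}\<close> to an independent subset \<open>K\<close> of \<open>I \<union> {a, b}\<close> of the size of \<open>I\<close>. If
  \<open>insert c I\<close> were independent, it would augment \<open>K\<close>, and neither by \<open>c\<close>, because of the dependent
  triple, nor by an element of \<open>I\<close>, since \<open>I\<close> spans \<open>K\<close>.\<close>

lemma spanned_dependent_triple:
  assumes H: "matroid_complex V H" and I: "I \<in> H" and ab: "{a, b} \<in> H" and abc: "{a, b, c} \<notin> H"
    and sp: "a \<in> spanned V H I" "b \<in> spanned V H I" and c: "c \<in> V"
  shows "c \<in> spanned V H I"
proof (rule ccontr)
  assume "c \<notin> spanned V H I"
  then have cI: "c \<notin> I" "insert c I \<in> H" using c by (auto simp: spanned_def)
  have cx: "abstract_complex V H" using H by (simp add: matroid_complex_def)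
  have Isp: "I \<subseteq> spanned V H I"
    using I cx by (auto simp: spanned_def abstract_complex_def)
  have "card {a, b} \<le> card I" using spanned_card_le[OF H I ab] sp by simp
  then obtain K where K: "K \<in> H" "{a, b} \<subseteq> K" "K \<subseteq> I \<union> {a, b}" "card K = card I"
    using matroid_augment_to_card[OF H I ab] by blast
  have "card (insert c I) = Suc (card I)" using cI(1) complex_finite[OF cx I] by simp
  then obtain i where i: "i \<in> insert c I - K" "insert i K \<in> H"
    using matroid_augment[OF H cI(2) K(1)] K(4) by auto
  have "i \<noteq> c" using i(2) K(2) abc complex_subset[OF cx i(2), of "{a, b, c}"] by auto
  then have "insert i K \<subseteq> spanned V H I" using i K(3) Isp sp by auto
  then have "card (insert i K) \<le> card I" by (rule spanned_card_le[OF H I i(2)])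
  then show False using i(1) K complex_finite[OF cx K(1)] by simp
qed

section \<open>The cycle matroid of \<open>K\<^sub>5\<close>\<close>

definition conn :: "'v set set \<Rightarrow> ('v \<times> 'v) set" where
  "conn X = {(a, b). {a, b} \<in> X}\<^sup>*"

text \<open>This is the closure of the cycle matroid of a complete graph. No vertex set has to be
  fixed: vertices not covered by \<open>X\<close> are isolated and contribute no pair.\<close>

definition edge_cl :: "'v set set \<Rightarrow> 'v set set" where
  "edge_cl X = {{u, v} | u v. u \<noteq> v \<and> (u, v) \<in> conn X}"

lemma conn_refl: "(u, u) \<in> conn X"
  by (simp add: conn_def)

lemma conn_edge: "{u, v} \<in> X \<Longrightarrow> (u, v) \<in> conn X"
  by (auto simp: conn_def)

lemma conn_trans: "(u, v) \<in> conn X \<Longrightarrow> (v, w) \<in> conn X \<Longrightarrow> (u, w) \<in> conn X"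
  by (auto simp: conn_def)

lemma conn_sym: "(u, v) \<in> conn X \<Longrightarrow> (v, u) \<in> conn X"
proof -
  have "sym {(a, b). {a, b} \<in> X}" by (auto simp: sym_def insert_commute)
  then show "(u, v) \<in> conn X \<Longrightarrow> (v, u) \<in> conn X"
    unfolding conn_def by (metis sym_rtrancl symD)
qed

lemma conn_mono: "X \<subseteq> Y \<Longrightarrow> conn X \<subseteq> conn Y"
  unfolding conn_def by (rule rtrancl_mono) auto

lemma conn_induct [consumes 1, case_names refl step]:
  assumes "(u, v) \<in> conn X" and "P u"
    and "\<And>v w. (u, v) \<in> conn X \<Longrightarrow> {v, w} \<in> X \<Longrightarrow> P v \<Longrightarrow> P w"
  shows "P v"
  using assms(1) unfolding conn_def
proof (induction rule: rtrancl_induct)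
  case base
  show ?case by fact
next
  case (step y z)
  then show ?case using assms(3) by (auto simp: conn_def)
qed

lemma edge_cl_iff: "{u, v} \<in> edge_cl X \<longleftrightarrow> u \<noteq> v \<and> (u, v) \<in> conn X"
  by (auto simp: edge_cl_def doubleton_eq_iff dest: conn_sym)

lemma edge_cl_mono: "X \<subseteq> Y \<Longrightarrow> edge_cl X \<subseteq> edge_cl Y"
  using conn_mono unfolding edge_cl_def by blast

lemma conn_edge_cl: "conn (edge_cl X) \<subseteq> conn X"
proof
  fix p assume p: "p \<in> conn (edge_cl X)"
  obtain u v where uv: "p = (u, v)" by (cases p)
  have "(u, v) \<in> conn X" using p unfolding uv
  proof (induction rule: conn_induct)
    case refl
    show ?case by (rule conn_refl)
  next
    case (step v w)
    then show ?case by (metis conn_trans edge_cl_iff)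
  qed
  then show "p \<in> conn X" by (simp add: uv)
qed

text \<open>A walk needs the new edge at most once, since a detour returning to an endpoint of it
  can be cut out. The last two cases are the two directions of crossing.\<close>

lemma conn_insert:
  assumes "(u, v) \<in> conn (insert {a, b} X)"
  shows "(u, v) \<in> conn X \<or> (u, a) \<in> conn X \<and> (b, v) \<in> conn X \<or> (u, b) \<in> conn X \<and> (a, v) \<in> conn X"
  using assms
proof (induction rule: conn_induct)
  case refl
  show ?case by (simp add: conn_refl)
next
  case (step v w)
  show ?case
  proof (cases "{v, w} \<in> X")
    case True
    then show ?thesis using step.IH conn_edge conn_trans by metis
  next
    case False
    then have "v = a \<and> w = b \<or> v = b \<and> w = a"
      using step.hyps by (auto simp: doubleton_eq_iff)
    then show ?thesis using step.IH conn_refl conn_sym conn_trans by metis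
  qed
qed

text \<open>A walk from \<open>c\<close> to \<open>d\<close> must cross the edge
  \<open>{a, b}\<close>, so \<open>c\<close> and \<open>d\<close> are joined in \<open>X\<close> to
  opposite ends of it. The edge \<open>{c, d}\<close> then links \<open>a\<close> to
  \<open>b\<close>.\<close>

lemma edge_cl_exchange:
  assumes y: "{c, d} \<in> edge_cl (insert {a, b} X)" "{c, d} \<notin> edge_cl X" and "a \<noteq> b"
  shows "{a, b} \<in> edge_cl (insert {c, d} X)"
proof -
  let ?Y = "insert {c, d} X"
  have cd: "c \<noteq> d" "(c, d) \<in> conn (insert {a, b} X)" "(c, d) \<notin> conn X"
    using y by (auto simp: edge_cl_iff)
  have "(c, a) \<in> conn X \<and> (b, d) \<in> conn X \<or> (c, b) \<in> conn X \<and> (a, d) \<in> conn X"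
    using conn_insert[OF cd(2)] cd(3) by blast
  then have "(c, a) \<in> conn ?Y \<and> (b, d) \<in> conn ?Y \<or> (c, b) \<in> conn ?Y \<and> (a, d) \<in> conn ?Y"
    using conn_mono[of X ?Y] by blast
  moreover have "(c, d) \<in> conn ?Y" by (simp add: conn_edge)
  ultimately have "(a, b) \<in> conn ?Y" by (meson conn_sym conn_trans)
  then show ?thesis using assms(3) by (simp add: edge_cl_iff)
qed

text \<open>A vertex not covered by \<open>X\<close> is isolated, so no walk leaves it. This
  certifies independence of explicit edge sets by exhibiting a vertex private to the added
  edge.\<close>

lemma edge_cl_not_incident:
  assumes "v \<in> e" and "v \<notin> \<Union>X"
  shows "e \<notin> edge_cl X"
proof
  assume "e \<in> edge_cl X"
  then obtain a b where "e = {a, b}" "a \<noteq> b" "(a, b) \<in> conn X"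
    by (auto simp: edge_cl_def)
  then obtain w where w: "w \<noteq> v" "(v, w) \<in> conn X"
    using assms(1) conn_sym by (metis empty_iff insert_iff)
  from w(2) have "w = v"
    by (induction rule: conn_induct) (use assms(2) in auto)
  with w(1) show False by simp
qed

text \<open>Completing triangles along a walk joins its start directly to every later vertex
  different from it. This reduces statements about the whole closure to statements about
  triangles.\<close>

lemma edge_cl_least:
  assumes "\<And>a b c. a \<noteq> c \<Longrightarrow> {a, b} \<in> T \<Longrightarrow> {b, c} \<in> T \<Longrightarrow> {a, c} \<in> T" and "X \<subseteq> T"
  shows "edge_cl X \<subseteq> T"
proof
  fix e assume "e \<in> edge_cl X"
  then obtain u v where e: "e = {u, v}" "u \<noteq> v" "(u, v) \<in> conn X"
    by (auto simp: edge_cl_def)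
  from e(3) have "u = v \<or> {u, v} \<in> T"
    by (induction rule: conn_induct) (use assms in auto)
  then show "e \<in> T" using e by simp
qed

lemma edge_cl_empty: "edge_cl {} = {}"
  using edge_cl_least[of "{}" "{}"] by simp

section \<open>The closure matroid on the edges of \<open>K\<^sub>5\<close>\<close>

lemma K5_edge_iff: "{u, v} \<in> K5_edges \<longleftrightarrow> u \<noteq> v \<and> u \<in> {1..5} \<and> v \<in> {1..5}"
  by (auto simp: K5_edges_def card_insert_if)

lemma K5_edgeE:
  assumes "e \<in> K5_edges"
  obtains u v where "e = {u, v}" "u \<noteq> v" "u \<in> {1..5}" "v \<in> {1..5}"
  using assms K5_edge_iff unfolding K5_edges_def by (auto simp: card_2_iff)

interpretation K5: closure_matroid K5_edges edge_cl
proof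
  show "finite K5_edges"
    by (rule finite_subset[of _ "Pow {1..5}"]) (auto simp: K5_edges_def)
  show "edge_cl X \<subseteq> K5_edges" if "X \<subseteq> K5_edges" for X
    using that by (intro edge_cl_least) (auto simp: K5_edge_iff)
  show ext: "X \<subseteq> edge_cl X" if "X \<subseteq> K5_edges" for X
  proof
    fix e assume e: "e \<in> X"
    then have "e \<in> K5_edges" using that by blast
    then obtain u v where "e = {u, v}" "u \<noteq> v" by (rule K5_edgeE)
    then show "e \<in> edge_cl X" using e by (simp add: edge_cl_iff conn_edge)
  qed
  show "edge_cl X \<subseteq> edge_cl Y" if "X \<subseteq> Y" for X Y :: "nat set set"
    using that by (rule edge_cl_mono)
  show "edge_cl (edge_cl X) = edge_cl X" if "X \<subseteq> K5_edges" for X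
  proof
    show "edge_cl (edge_cl X) \<subseteq> edge_cl X"
      using conn_edge_cl[of X] unfolding edge_cl_def[of "edge_cl X"] by (auto simp: edge_cl_iff)
    show "edge_cl X \<subseteq> edge_cl (edge_cl X)" using ext[OF that] by (rule edge_cl_mono)
  qed
  show "x \<in> edge_cl (insert y X)"
    if "x \<in> K5_edges" "y \<in> K5_edges" "y \<in> edge_cl (insert x X)" "y \<notin> edge_cl X" for x y X
    using that by (metis K5_edgeE edge_cl_exchange)
qed

section \<open>Forests as independent sets\<close>

lemma conn_distinct_path:
  assumes "(u, v) \<in> conn X"
  shows "\<exists>vs. vs \<noteq> [] \<and> hd vs = u \<and> last vs = v \<and> distinct vs \<and>
    (\<forall>i. Suc i < length vs \<longrightarrow> {vs ! i, vs ! Suc i} \<in> X)"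
  using assms
proof (induction rule: conn_induct)
  case refl
  show ?case by (intro exI[of _ "[u]"]) simp
next
  case (step v w)
  then obtain vs where vs: "vs \<noteq> []" "hd vs = u" "last vs = v" "distinct vs"
    and path: "\<And>i. Suc i < length vs \<Longrightarrow> {vs ! i, vs ! Suc i} \<in> X" by blast
  show ?case
  proof (cases "w \<in> set vs")
    case True
    then obtain j where j: "j < length vs" "vs ! j = w" by (auto simp: in_set_conv_nth)
    \<comment> \<open>The walk has returned to \<open>w\<close>, so the path is cut off just after
      its earlier occurrence at position \<open>j\<close>.\<close>
    let ?ws = "take (Suc j) vs"
    have "last ?ws = w" using j by (simp add: take_Suc_conv_app_nth)
    moreover have "{?ws ! i, ?ws ! Suc i} \<in> X" if "Suc i < length ?ws" for i
      using that path[of i] j by simp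
    ultimately show ?thesis using vs j by (intro exI[of _ ?ws]) (auto simp: hd_conv_nth)
  next
    case False
    let ?ws = "vs @ [w]"
    have "{?ws ! i, ?ws ! Suc i} \<in> X" if "Suc i < length ?ws" for i
    proof (cases "Suc i < length vs")
      case True
      then show ?thesis using path[of i] by (simp add: nth_append)
    next
      case False
      then have "i = length vs - 1" "length vs = Suc i" using that vs(1) by auto
      then show ?thesis using vs(1,3) step.hyps by (simp add: nth_append last_conv_nth)
    qed
    then show ?thesis using vs False by (intro exI[of _ ?ws]) auto
  qed
qed

text \<open>The edge closing the cycle is spanned by the path formed by the other edges.\<close>

lemma cycle_imp_edge_cl:
  assumes "graph_cycle X vs"
  shows "\<exists>e\<in>X. e \<in> edge_cl (X - {e})"
proof -
  define n where "n = length vs - 1"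
  have n: "length vs = Suc n" "n \<ge> 2" and dist: "distinct vs"
    and E: "\<And>i. i < length vs \<Longrightarrow> {vs ! i, vs ! (Suc i mod length vs)} \<in> X"
    using assms by (auto simp: graph_cycle_def n_def)
  let ?e = "{vs ! 0, vs ! n}"
  have "?e \<in> X" using E[of n] n by (simp add: insert_commute)
  moreover have "(vs ! 0, vs ! m) \<in> conn (X - {?e})" if "m \<le> n" for m
    using that
  proof (induction m)
    case 0
    show ?case by (rule conn_refl)
  next
    case (Suc m)
    have "{vs ! m, vs ! Suc m} \<in> X" using E[of m] Suc.prems n by simp
    \<comment> \<open>Both ends could agree with those of the closing edge only for
      \<open>n = 1\<close>, which the length of the cycle excludes.\<close>
    moreover have "{vs ! m, vs ! Suc m} \<noteq> ?e"
      using Suc.prems n dist by (auto simp: doubleton_eq_iff nth_eq_iff_index_eq)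
    ultimately have "(vs ! m, vs ! Suc m) \<in> conn (X - {?e})" by (intro conn_edge) auto
    then show ?case using Suc by (auto intro: conn_trans)
  qed
  moreover have "vs ! 0 \<noteq> vs ! n" using n dist by (simp add: nth_eq_iff_index_eq)
  ultimately show ?thesis by (intro bexI[of _ ?e]) (auto simp: edge_cl_iff)
qed

text \<open>A path that joins the ends of \<open>e\<close> while avoiding \<open>e\<close> is closed
  to a cycle by \<open>e\<close>.\<close>

lemma edge_cl_imp_cycle:
  assumes e: "e \<in> X" "e \<in> edge_cl (X - {e})"
  shows "\<exists>vs. graph_cycle X vs"
proof -
  obtain u v where uv: "e = {u, v}" "u \<noteq> v" "(u, v) \<in> conn (X - {e})"
    using e(2) unfolding edge_cl_def by auto
  then obtain vs where vs: "vs \<noteq> []" "hd vs = u" "last vs = v" "distinct vs"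
    and path: "\<And>i. Suc i < length vs \<Longrightarrow> {vs ! i, vs ! Suc i} \<in> X - {e}"
    using conn_distinct_path by metis
  define n where "n = length vs - 1"
  have n: "length vs = Suc n" using vs(1) by (simp add: n_def)
  have ends: "vs ! 0 = u" "vs ! n = v"
    using vs by (simp_all add: hd_conv_nth last_conv_nth n_def)
  have "n \<noteq> 0" using ends uv(2) by metis
  \<comment> \<open>A path with a single edge would be \<open>e\<close> itself. Hence there are at
    least three vertices, as \<open>graph_cycle\<close> demands.\<close>
  moreover have "n \<noteq> 1"
  proof
    assume "n = 1"
    then have "{vs ! 0, vs ! 1} \<in> X - {e}" using path[of 0] n by simp
    then show False using ends uv(1) \<open>n = 1\<close> by simp
  qed
  moreover have "{vs ! i, vs ! (Suc i mod length vs)} \<in> X" if "i < length vs" for i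
  proof (cases "i = n")
    case True
    then show ?thesis using n ends uv(1) e(1) by (simp add: insert_commute)
  next
    case False
    then show ?thesis using that n path[of i] by simp
  qed
  ultimately have "graph_cycle X vs" using n vs(4) by (auto simp: graph_cycle_def)
  then show ?thesis ..
qed

lemma forest_iff_indep: "X \<subseteq> K5_edges \<Longrightarrow> forest_edges X \<longleftrightarrow> K5.indep X"
  using cycle_imp_edge_cl edge_cl_imp_cycle unfolding forest_edges_def K5.indep_def by blast

section \<open>Small independent sets and bases of the cycle matroid\<close>

lemma Desargues_eq: "Desargues = {X. K5.indep X \<and> card X \<le> 3}"
  using forest_iff_indep K5.indep_subset_V by (auto simp: Desargues_def)

text \<open>Two edges either coincide or one has an endpoint off the other. With
  \<open>triangle_not_indep\<close> this shows that triangles are circuits.\<close>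

lemma indep_pair:
  assumes "e \<in> K5_edges" and "f \<in> K5_edges"
  shows "K5.indep {e, f}"
proof -
  have single: "K5.indep {f}" if "f \<in> K5_edges" for f
    using that by (intro K5.indep_insert K5.indep_empty) (simp_all add: edge_cl_empty)
  show ?thesis
  proof (cases "e \<subseteq> f")
    case True
    then have "e = f" using assms by (auto elim!: K5_edgeE)
    then show ?thesis using single assms by simp
  next
    case False
    then obtain v where "v \<in> e" "v \<notin> f" by blast
    then have "e \<notin> edge_cl {f}" by (intro edge_cl_not_incident) auto
    then show ?thesis using K5.indep_insert[OF single] assms by blast
  qed
qed

lemma triangle_not_indep:
  assumes "a \<noteq> b" "b \<noteq> c" "a \<noteq> c"
  shows "\<not> K5.indep {{a, b}, {b, c}, {a, c}}"
proof -
  have "{{a, b}, {b, c}, {a, c}} - {{a, c}} = {{a, b}, {b, c}}"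
    using assms by (auto simp: doubleton_eq_iff)
  moreover have "{a, c} \<in> edge_cl {{a, b}, {b, c}}"
    using assms by (auto simp: edge_cl_iff intro: conn_trans[of a b] conn_edge)
  ultimately show ?thesis unfolding K5.indep_def by auto
qed

text \<open>Each added ray ends in a vertex not yet covered. This spanning tree fixes the rank as 4
  and shows that the extension by all forests is proper.\<close>

lemma indep_star: "K5.indep {{1, 2}, {1, 3}, {1, 4}, {1, 5}}"
proof -
  have "K5.indep {{1, 4}, {1, 5}}" by (rule indep_pair) (simp_all add: K5_edge_iff)
  moreover have "{1, 3} \<notin> edge_cl {{1, 4}, {1, 5::nat}}"
    by (rule edge_cl_not_incident[of 3]) auto
  ultimately have "K5.indep {{1, 3}, {1, 4}, {1, 5}}"
    using K5.indep_insert K5_edge_iff[of 1 3] by simp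
  moreover have "{1, 2} \<notin> edge_cl {{1, 3}, {1, 4}, {1, 5::nat}}"
    by (rule edge_cl_not_incident[of 2]) auto
  ultimately show ?thesis
    using K5.indep_insert K5_edge_iff[of 1 2] by simp
qed

lemma card_star: "card {{1, 2}, {1, 3}, {1, 4}, {1, 5::nat}} = 4"
  by (simp add: doubleton_eq_iff)

lemma edge_cl_star: "K5_edges \<subseteq> edge_cl {{1, 2}, {1, 3}, {1, 4}, {1, 5}}"
proof
  let ?S = "{{1, 2}, {1, 3}, {1, 4}, {1, 5::nat}}"
  have c: "(1, v) \<in> conn ?S" if "v \<in> {1..5}" for v
  proof -
    have "v = 1 \<or> v = 2 \<or> v = 3 \<or> v = 4 \<or> v = 5" using that by auto
    then show ?thesis by (auto intro: conn_edge conn_refl)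
  qed
  fix e assume "e \<in> K5_edges"
  then obtain u v where "e = {u, v}" "u \<noteq> v" "u \<in> {1..5}" "v \<in> {1..5}" by (rule K5_edgeE)
  then show "e \<in> edge_cl ?S" using c conn_sym conn_trans by (metis edge_cl_iff)
qed

lemma indep_card_le_4: "K5.indep X \<Longrightarrow> card X \<le> 4"
  using K5.indep_card_le[OF _ K5.indep_subset_V[OF indep_star]] edge_cl_star
    K5.indep_subset_V card_star by (metis order_trans)

text \<open>An edge outside the closure would extend \<open>X\<close> to five independent edges,
  exceeding the rank.\<close>

lemma indep_card_4_spans:
  assumes X: "K5.indep X" and "card X = 4"
  shows "K5_edges \<subseteq> edge_cl X"
proof
  fix e assume e: "e \<in> K5_edges"
  show "e \<in> edge_cl X"
  proof (rule ccontr)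
    assume n: "e \<notin> edge_cl X"
    then have "e \<notin> X" using K5.cl_extensive[OF K5.indep_subset_V[OF X]] by blast
    then have "card (insert e X) = 5" using assms K5.indep_finite by simp
    then show False using indep_card_le_4[OF K5.indep_insert[OF X e n]] by simp
  qed
qed

section \<open>Matroid extensions of the Desargues complex\<close>

lemma matroid_K5: "matroid_complex K5_edges (Collect K5.indep)"
proof (rule K5.matroid_complex_indep)
  show "K5_edges \<noteq> {}" using K5_edge_iff[of 1 2] by auto
  show "e \<notin> edge_cl {}" for e :: "nat set"
    by (simp add: edge_cl_empty)
qed

section \<open>The families \<open>T(D)\<close> and \<open>J(T(D))\<close>\<close>

lemma complex_dim_Desargues: "complex_dim Desargues = 2"
proof -
  let ?S = "{{1, 2}, {1, 3}, {1, 4::nat}}"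
  have "K5.indep ?S" by (rule K5.indep_subset[OF indep_star]) auto
  moreover have card: "card ?S = 3" by (simp add: doubleton_eq_iff)
  ultimately have "?S \<in> Desargues" by (simp add: Desargues_eq)
  then have "3 \<in> card ` Desargues" using card by (metis imageI)
  moreover have "card ` Desargues \<subseteq> {..3}" by (auto simp: Desargues_eq)
  ultimately have "Max (card ` Desargues) = 3"
    using finite_subset by (intro Max_eqI) auto
  then show ?thesis by (simp add: complex_dim_def)
qed

text \<open>In dimension 2 the test sets have at most two edges. Two sides of a triangle force the
  third into \<open>T\<close>, since the three do not form a forest. Conversely, an edge outside a
  flat is outside the closure of every \<open>X\<close> in it, so adding it leaves a forest with at
  most three edges.\<close>

lemma T_family_Desargues: "T_family K5_edges Desargues = {T. T \<subseteq> K5_edges \<and> edge_cl T = T}"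
proof (intro equalityI subsetI)
  fix T assume "T \<in> T_family K5_edges Desargues"
  then have TV: "T \<subseteq> K5_edges"
    and T: "\<And>X p. X \<in> Desargues \<Longrightarrow> card X \<le> 2 \<Longrightarrow> X \<subseteq> T \<Longrightarrow> p \<in> K5_edges - T \<Longrightarrow> X \<union> {p} \<in> Desargues"
    by (auto simp: T_family_def complex_dim_Desargues)
  have "{a, c} \<in> T" if "a \<noteq> c" "{a, b} \<in> T" "{b, c} \<in> T" for a b c
  proof (rule ccontr)
    assume n: "{a, c} \<notin> T"
    have ed: "{a, b} \<in> K5_edges" "{b, c} \<in> K5_edges" using that TV by auto
    then have abc: "a \<noteq> b" "b \<noteq> c" "{a, c} \<in> K5_edges" using that(1) by (auto simp: K5_edge_iff)
    have "card {{a, b}, {b, c}} \<le> 2" by (simp add: card_insert_if)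
    moreover from this have "{{a, b}, {b, c}} \<in> Desargues"
      using indep_pair[OF ed] by (simp add: Desargues_eq)
    ultimately have "{{a, b}, {b, c}} \<union> {{a, c}} \<in> Desargues"
      using that n abc by (intro T) auto
    then have "K5.indep {{a, b}, {b, c}, {a, c}}" by (simp add: Desargues_eq insert_commute)
    then show False using triangle_not_indep that(1) abc by blast
  qed
  then have "edge_cl T \<subseteq> T" by (intro edge_cl_least) auto
  then show "T \<in> {T. T \<subseteq> K5_edges \<and> edge_cl T = T}" using TV K5.cl_extensive by blast
next
  fix T assume "T \<in> {T. T \<subseteq> K5_edges \<and> edge_cl T = T}"
  then have T: "T \<subseteq> K5_edges" "edge_cl T = T" by auto
  have "X \<union> {p} \<in> Desargues"
    if "X \<in> Desargues" "card X \<le> 2" "X \<subseteq> T" "p \<in> K5_edges - T" for X p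
  proof -
    have "p \<notin> edge_cl X" using that(3,4) edge_cl_mono T(2) by blast
    then have "K5.indep (insert p X)"
      using that K5.indep_insert by (auto simp: Desargues_eq)
    moreover have "card (insert p X) \<le> 3"
      using that(2) card_insert_le_m1[of 3 X p] by simp
    ultimately show ?thesis by (simp add: Desargues_eq)
  qed
  then show "T \<in> T_family K5_edges Desargues"
    using T(1) by (auto simp: T_family_def complex_dim_Desargues)
qed

lemma J_family_Desargues: "J_family (T_family K5_edges Desargues) = Collect K5.indep"
  unfolding T_family_Desargues by (rule K5.J_family_flats)

lemma proper_extension_K5: "proper_complex_extension K5_edges Desargues (Collect K5.indep)"
proof -
  have cx: "abstract_complex K5_edges (Collect K5.indep)"
    using matroid_K5 by (simp add: matroid_complex_def)
  have "abstract_complex K5_edges Desargues"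
    unfolding abstract_complex_def
  proof (intro conjI ballI allI impI)
    show "finite K5_edges" "K5_edges \<noteq> {}" "Desargues \<subseteq> Pow K5_edges"
      using cx by (auto simp: abstract_complex_def Desargues_def)
    show "{v} \<in> Desargues" if "v \<in> K5_edges" for v
      using cx that by (auto simp: abstract_complex_def Desargues_eq)
    show "Y \<in> Desargues" if "X \<in> Desargues" "Y \<subseteq> X" for X Y
      using that card_mono[OF K5.indep_finite, of X Y] K5.indep_subset[of X Y]
      by (auto simp: Desargues_eq)
  qed
  moreover have "Collect K5.indep \<inter> {X. X \<subseteq> K5_edges \<and> card X \<le> 3} = Desargues"
    using K5.indep_subset_V by (auto simp: Desargues_eq)
  moreover have "Collect K5.indep \<noteq> Desargues"
  proof -
    have "{{1, 2}, {1, 3}, {1, 4}, {1, 5}} \<notin> Desargues"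
      using card_star unfolding Desargues_eq by simp
    then show ?thesis using indep_star by auto
  qed
  ultimately show ?thesis
    using cx by (simp add: proper_complex_extension_def complex_extension_def complex_dim_Desargues)
qed

text \<open>Since \<open>H\<close> agrees with the forests on sets of at most three edges, triangles
  are circuits of \<open>H\<close>. By \<open>spanned_dependent_triple\<close> the spanned set is
  therefore closed under completing triangles, and \<open>edge_cl_least\<close> applies.\<close>

lemma edge_cl_subset_spanned:
  assumes H: "matroid_complex K5_edges H" "complex_extension K5_edges Desargues H"
    and I: "I \<in> H" and A: "A \<subseteq> spanned K5_edges H I"
  shows "edge_cl A \<subseteq> spanned K5_edges H I"
proof (rule edge_cl_least[OF _ A])
  fix a b c
  assume ac: "a \<noteq> c" and sp: "{a, b} \<in> spanned K5_edges H I" "{b, c} \<in> spanned K5_edges H I"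
  have small: "X \<in> H \<longleftrightarrow> K5.indep X" if "X \<subseteq> K5_edges" "card X \<le> 3" for X
  proof -
    have "H \<inter> {X. X \<subseteq> K5_edges \<and> card X \<le> 3} = Desargues"
      using H(2) by (simp add: complex_extension_def complex_dim_Desargues)
    then have "X \<in> H \<longleftrightarrow> X \<in> Desargues" using that by blast
    then show ?thesis using that by (simp add: Desargues_eq)
  qed
  have ed: "{a, b} \<in> K5_edges" "{b, c} \<in> K5_edges" using sp by (auto simp: spanned_def)
  then have abc: "a \<noteq> b" "b \<noteq> c" "{a, c} \<in> K5_edges" using ac by (auto simp: K5_edge_iff)
  have "{{a, b}, {b, c}} \<in> H"
    using indep_pair[OF ed] ed by (subst small) (auto simp: card_insert_if)
  moreover have "{{a, b}, {b, c}, {a, c}} \<notin> H"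
    using triangle_not_indep[OF abc(1,2) ac] ed abc by (subst small) (auto simp: card_insert_if)
  ultimately show "{a, c} \<in> spanned K5_edges H I"
    using spanned_dependent_triple[OF H(1) I] sp abc(3) by blast
qed

lemma matroid_extension_unique:
  assumes H: "matroid_complex K5_edges H" and ext: "proper_complex_extension K5_edges Desargues H"
  shows "H = Collect K5.indep"
proof -
  have cx: "abstract_complex K5_edges H" using H by (simp add: matroid_complex_def)
  have cext: "complex_extension K5_edges Desargues H" and "H \<noteq> Desargues"
    using ext by (auto simp: proper_complex_extension_def)
  have HV: "X \<subseteq> K5_edges" if "X \<in> H" for X
    using cx that by (auto simp: abstract_complex_def)
  have small: "H \<inter> {X. X \<subseteq> K5_edges \<and> card X \<le> 3} = Desargues"
    using cext by (simp add: complex_extension_def complex_dim_Desargues)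
  \<comment> \<open>Up to three elements \<open>H\<close> coincides with \<open>Desargues\<close>,
    so properness forces a member \<open>B\<close> with at least four.\<close>
  then have "\<not> (\<forall>X\<in>H. card X \<le> 3)" using \<open>H \<noteq> Desargues\<close> HV by blast
  then obtain B where B: "B \<in> H" "card B \<ge> 4" by force
  note cl_spanned = edge_cl_subset_spanned[OF H cext]
  show ?thesis
  proof (intro equalityI subsetI)
    fix X assume X: "X \<in> H"
    \<comment> \<open>Otherwise \<open>X - {e}\<close> would span \<open>e\<close> in
      \<open>H\<close>, which means that \<open>X\<close> itself is not in \<open>H\<close>.\<close>
    have "e \<notin> edge_cl (X - {e})" if e: "e \<in> X" for e
    proof
      assume "e \<in> edge_cl (X - {e})"
      moreover have "X - {e} \<in> H" using complex_subset[OF cx X] by blast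
      moreover from this have "X - {e} \<subseteq> spanned K5_edges H (X - {e})"
        using HV by (auto simp: spanned_def)
      ultimately have "e \<in> spanned K5_edges H (X - {e})" using cl_spanned by blast
      then show False using e X by (simp add: spanned_def insert_absorb)
    qed
    then show "X \<in> Collect K5.indep" using HV[OF X] by (simp add: K5.indep_def)
  next
    fix X assume "X \<in> Collect K5.indep"
    then have X: "K5.indep X" by simp
    show "X \<in> H"
    proof (cases "card X \<le> 3")
      case True
      then have "X \<in> Desargues" using X by (simp add: Desargues_eq)
      then show ?thesis using small by blast
    next
      case False
      then have X4: "card X = 4" using indep_card_le_4[OF X] by simp
      have finX: "finite X" using X by (rule K5.indep_finite)
      have "{} \<in> H" using complex_subset[OF cx B(1)] by blast
      \<comment> \<open>\<open>I\<close> is a largest subset of \<open>X\<close> lying in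
        \<open>H\<close>, so it spans \<open>X\<close> in \<open>H\<close>. The bound
        \<open>Suc (card X)\<close> lies strictly above the size of every subset of
        \<open>X\<close>.\<close>
      then obtain I where I: "I \<in> H" "I \<subseteq> X"
        and max: "\<And>I'. I' \<in> H \<Longrightarrow> I' \<subseteq> X \<Longrightarrow> card I' \<le> card I"
        using ex_has_greatest_nat[of "\<lambda>I. I \<in> H \<and> I \<subseteq> X" "{}" card "Suc (card X)"] card_mono[OF finX]
        by (auto simp: less_Suc_eq_le)
      have finI: "finite I" using I(2) finX by (rule finite_subset)
      have "e \<in> spanned K5_edges H I" if "e \<in> X" for e
      proof -
        have "insert e I \<notin> H" if "e \<notin> I"
          using max[of "insert e I"] that \<open>e \<in> X\<close> I(2) finI by auto
        then show ?thesis using that K5.indep_subset_V[OF X] by (auto simp: spanned_def)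
      qed
      then have "edge_cl X \<subseteq> spanned K5_edges H I" using cl_spanned[OF I(1)] by blast
      \<comment> \<open>A forest with four edges has all edges in its closure, so \<open>I\<close>
        spans \<open>B\<close>. Hence \<open>I\<close> has at least four elements and fills
        \<open>X\<close>.\<close>
      then have "B \<subseteq> spanned K5_edges H I"
        using indep_card_4_spans[OF X X4] HV[OF B(1)] by blast
      then have "card B \<le> card I" by (rule spanned_card_le[OF H I(1) B(1)])
      then have "I = X" using card_seteq[OF finX I(2)] X4 B(2) by simp
      then show ?thesis using I(1) by simp
    qed
  qed
qed

theorem theorem9p3:
  shows "proper_complex_extension K5_edges Desargues (J_family (T_family K5_edges Desargues)) \<and>
         matroid_complex K5_edges (J_family (T_family K5_edges Desargues)) \<and>
         (\<forall>H'. proper_complex_extension K5_edges Desargues H' \<and> matroid_complex K5_edges H' \<longrightarrow>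
               H' = J_family (T_family K5_edges Desargues))"
  unfolding J_family_Desargues
  using proper_extension_K5 matroid_K5 matroid_extension_unique by blast

end
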